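(* Let $X$ be a zero-dimensional Hausdorff space, let $\mathcal P$ be an ideal of closed sets in $X$, and suppose that $X$ is locally $\mathcal P$. Then the following statements are equivalent: (1) $C_{\mathcal P}(X)\cap C_c(X)$ is a Noetherian ring. (2) $C_{\mathcal P}(X)\cap C_c(X)$ is an Artinian ring. (3) $C_\infty^{\mathcal P}(X)\cap C_c(X)$ is a Noetherian ring. (4) $C_\infty^{\mathcal P}(X)\cap C_c(X)$ is an Artinian ring. (5) $X$ is a finite set.
   Context: A space is zero-dimensional if its clopen sets form a base for its topology. $C(X)$ is the ring of real-valued continuous functions on $X$, $Z(f)=\{x\in X: f(x)=0\}$, and $C_c(X)$ is the subring of those $f\in C(X)$ with countable range. A family $\mathcal P$ of closed sets in $X$ is an ideal of closed sets if it is closed under finite unions and every closed subset of a member of $\mathcal P$ belongs to $\mathcal P$. $X$ is locally $\mathcal P$ if each point of $X$ has an open neighbourhood whose closure belongs to $\mathcal P$. Define the subrings (not necessarily with identity) of $C(X)$: $C_{\mathcal P}(X)=\{f\in C(X): \mathrm{cl}_X(X\setminus Z(f))\in\mathcal P\}$ and $C_\infty^{\mathcal P}(X)=\{f\in C(X): \{x\in X:|f(x)|\ge \tfrac1n\}\in\mathcal P\text{ for each }n\in\mathbb N\}$. A commutative ring, with or without identity, is Noetherian (respectively Artinian) if every ascending (respectively descending) sequence of its ideals terminates at a finite stage. *)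

theory Defs
  imports "HOL-Analysis.Analysis" "HOL-Algebra.Ideal"
begin

section \<open>Commutative rings with or without identity\<close>

text \<open>The locales \<^locale>\<open>ring\<close>, \<^locale>\<open>ideal\<close> and \<open>noetherian_ring\<close> of HOL-Algebra all require
  a multiplicative identity. Here the field \<open>one\<close> of the record is never used, and
  it need not belong to the carrier.\<close>

locale comm_rng = abelian_group R for R (structure) +
  assumes rng_m_closed: "\<lbrakk>x \<in> carrier R; y \<in> carrier R\<rbrakk> \<Longrightarrow> x \<otimes> y \<in> carrier R"
    and rng_m_assoc: "\<lbrakk>x \<in> carrier R; y \<in> carrier R; z \<in> carrier R\<rbrakk>
      \<Longrightarrow> (x \<otimes> y) \<otimes> z = x \<otimes> (y \<otimes> z)"
    and rng_m_comm: "\<lbrakk>x \<in> carrier R; y \<in> carrier R\<rbrakk> \<Longrightarrow> x \<otimes> y = y \<otimes> x"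
    and rng_l_distr: "\<lbrakk>x \<in> carrier R; y \<in> carrier R; z \<in> carrier R\<rbrakk>
      \<Longrightarrow> (x \<oplus> y) \<otimes> z = x \<otimes> z \<oplus> y \<otimes> z"

locale rng_ideal = additive_subgroup I R + comm_rng R for I and R (structure) +
  assumes rng_I_closed: "\<lbrakk>a \<in> I; x \<in> carrier R\<rbrakk> \<Longrightarrow> x \<otimes> a \<in> I"

locale noetherian_rng = comm_rng +
  assumes ascending_chain: "\<lbrakk>\<And>n::nat. rng_ideal (I n) R; \<And>n. I n \<subseteq> I (Suc n)\<rbrakk>
    \<Longrightarrow> \<exists>N. \<forall>n\<ge>N. I n = I N"

locale artinian_rng = comm_rng +
  assumes descending_chain: "\<lbrakk>\<And>n::nat. rng_ideal (I n) R; \<And>n. I (Suc n) \<subseteq> I n\<rbrakk>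
    \<Longrightarrow> \<exists>N. \<forall>n\<ge>N. I n = I N"

section \<open>Zero-dimensional spaces and ideals of closed sets\<close>

definition zero_dimensional_space :: "'a topology \<Rightarrow> bool" where
  "zero_dimensional_space X \<longleftrightarrow>
     openin X = arbitrary union_of (\<lambda>U. openin X U \<and> closedin X U)"

text \<open>Finite unions include the empty one, so that the empty set is always a member.
  For a nonempty space that is locally \<open>P\<close> this is automatic; for the empty space it
  excludes the family without members.\<close>

definition closed_set_ideal :: "'a topology \<Rightarrow> 'a set set \<Rightarrow> bool" where
  "closed_set_ideal X P \<longleftrightarrow>
     (\<forall>A\<in>P. closedin X A) \<and>
     (\<forall>F. finite F \<and> F \<subseteq> P \<longrightarrow> \<Union>F \<in> P) \<and>
     (\<forall>A\<in>P. \<forall>B. closedin X B \<and> B \<subseteq> A \<longrightarrow> B \<in> P)"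

definition locally_in :: "'a topology \<Rightarrow> 'a set set \<Rightarrow> bool" where
  "locally_in X P \<longleftrightarrow>
     (\<forall>x\<in>topspace X. \<exists>U. openin X U \<and> x \<in> U \<and> X closure_of U \<in> P)"

section \<open>Rings of continuous functions\<close>

text \<open>Functions on \<open>topspace X\<close> are represented by their extensional extensions (with value
  \<open>undefined\<close> outside \<open>topspace X\<close>), so that equality in the carrier is equality of
  functions on the space.\<close>

definition cont_ring :: "'a topology \<Rightarrow> ('a \<Rightarrow> real) ring" where
  "cont_ring X = \<lparr>
     carrier = {f \<in> extensional (topspace X). continuous_map X euclideanreal f},
     mult = (\<lambda>f g. \<lambda>x\<in>topspace X. f x * g x),
     one = (\<lambda>x\<in>topspace X. 1),
     zero = (\<lambda>x\<in>topspace X. 0),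
     add = (\<lambda>f g. \<lambda>x\<in>topspace X. f x + g x)\<rparr>"

definition zero_set :: "'a topology \<Rightarrow> ('a \<Rightarrow> real) \<Rightarrow> 'a set" where
  "zero_set X f = {x \<in> topspace X. f x = 0}"

definition C_countable :: "'a topology \<Rightarrow> ('a \<Rightarrow> real) set" where
  "C_countable X = {f \<in> carrier (cont_ring X). countable (f ` topspace X)}"

definition C_ideal :: "'a topology \<Rightarrow> 'a set set \<Rightarrow> ('a \<Rightarrow> real) set" where
  "C_ideal X P =
     {f \<in> carrier (cont_ring X). X closure_of (topspace X - zero_set X f) \<in> P}"

definition C_infinity :: "'a topology \<Rightarrow> 'a set set \<Rightarrow> ('a \<Rightarrow> real) set" where
  "C_infinity X P =
     {f \<in> carrier (cont_ring X).
        \<forall>n::nat. n \<ge> 1 \<longrightarrow> {x \<in> topspace X. \<bar>f x\<bar> \<ge> 1 / real n} \<in> P}"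

definition subring_on :: "'a topology \<Rightarrow> ('a \<Rightarrow> real) set \<Rightarrow> ('a \<Rightarrow> real) ring" where
  "subring_on X S = (cont_ring X)\<lparr>carrier := S\<rparr>"

end

theory Submission
  imports Defs
begin

text \<open>For an infinite \<open>X\<close>, splitting off a nonempty clopen piece while keeping an infinite
  clopen remainder gives a strictly decreasing sequence of clopen sets. The functions of the ring
  that are supported in these sets (respectively, that vanish on them) form a strictly decreasing
  (respectively increasing) sequence of ideals; strictness is witnessed by indicator functions of
  small clopen sets, which lie in the ring because \<open>X\<close> is locally \<open>P\<close>. For a finite \<open>X\<close>, which is
  discrete, an ideal is determined by the union of the cozero sets of its members, so there are
  only finitely many ideals.\<close>

section \<open>Scaled indicators of clopen sets\<close>

text \<open>The factor \<open>c\<close> serves to match prescribed values when the space is finite.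
  Restricting to \<open>topspace X\<close> makes the function extensional, as membership in the
  carrier demands.\<close>

definition step_fun :: "'a topology \<Rightarrow> 'a set \<Rightarrow> real \<Rightarrow> 'a \<Rightarrow> real" where
  "step_fun X A c = (\<lambda>x\<in>topspace X. if x \<in> A then c else 0)"

text \<open>The preimage of any set is one of four sets built from \<open>A\<close>, and all four
  are open because \<open>A\<close> is clopen.\<close>

lemma step_fun_continuous:
  assumes "openin X A" "closedin X A"
  shows "continuous_map X euclideanreal (step_fun X A c)"
proof -
  have "{x \<in> topspace X. step_fun X A c x \<in> U} \<in>
      {{}, A, topspace X - A, topspace X}" for U
    using openin_subset[OF assms(1)] by (auto simp: step_fun_def)
  moreover have "\<forall>B\<in>{{}, A, topspace X - A, topspace X}. openin X B"
    using assms by (simp add: openin_diff)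
  ultimately have "openin X {x \<in> topspace X. step_fun X A c x \<in> U}" for U
    by (rule bspec[rotated])
  then show ?thesis
    by (simp add: continuous_map_def)
qed

lemma step_fun_in_carrier:
  "openin X A \<Longrightarrow> closedin X A \<Longrightarrow> step_fun X A c \<in> carrier (cont_ring X)"
  by (simp add: cont_ring_def step_fun_continuous) (simp add: step_fun_def)

lemma step_fun_in_C_countable:
  assumes "openin X A" "closedin X A"
  shows "step_fun X A c \<in> C_countable X"
proof -
  have "step_fun X A c ` topspace X \<subseteq> {0, c}"
    by (auto simp: step_fun_def)
  then have "countable (step_fun X A c ` topspace X)"
    by (rule countable_subset) simp
  then show ?thesis
    by (simp add: C_countable_def step_fun_in_carrier assms)
qed

lemma zero_dimensional_space_base:
  assumes "zero_dimensional_space X" "openin X U" "x \<in> U"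
  obtains V where "openin X V" "closedin X V" "x \<in> V" "V \<subseteq> U"
proof -
  have "(arbitrary union_of (\<lambda>U. openin X U \<and> closedin X U)) U"
    using assms by (simp add: zero_dimensional_space_def)
  then show thesis
    using that assms(3) unfolding union_of_def arbitrary_def by auto
qed

section \<open>Rings of real functions and ideals given by supports\<close>

text \<open>Isolates the closure properties shared by the two rings of the theorem, so that their
  ideals are treated once. Membership of the constant 1 is left out because those rings may lack
  it.\<close>

locale real_fun_rng =
  fixes X :: "'a topology" and S :: "('a \<Rightarrow> real) set"
  assumes S_subset: "S \<subseteq> carrier (cont_ring X)"
    and S_zero: "(\<lambda>x\<in>topspace X. 0) \<in> S"
    and S_add: "f \<in> S \<Longrightarrow> g \<in> S \<Longrightarrow> (\<lambda>x\<in>topspace X. f x + g x) \<in> S"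
    and S_uminus: "f \<in> S \<Longrightarrow> (\<lambda>x\<in>topspace X. - f x) \<in> S"
    and S_mult: "f \<in> S \<Longrightarrow> g \<in> S \<Longrightarrow> (\<lambda>x\<in>topspace X. f x * g x) \<in> S"
begin

abbreviation "R \<equiv> subring_on X S"

lemma R_simps [simp]:
  "carrier R = S"
  "f \<oplus>\<^bsub>R\<^esub> g = (\<lambda>x\<in>topspace X. f x + g x)"
  "f \<otimes>\<^bsub>R\<^esub> g = (\<lambda>x\<in>topspace X. f x * g x)"
  "\<zero>\<^bsub>R\<^esub> = (\<lambda>x\<in>topspace X. 0)"
  by (simp_all add: subring_on_def cont_ring_def)

lemma S_extensional: "f \<in> S \<Longrightarrow> f \<in> extensional (topspace X)"
  using S_subset by (auto simp: cont_ring_def)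

lemma S_eqI: "f \<in> S \<Longrightarrow> g \<in> S \<Longrightarrow> (\<And>x. x \<in> topspace X \<Longrightarrow> f x = g x) \<Longrightarrow> f = g"
  by (rule extensionalityI[OF S_extensional S_extensional])

lemma abelian_group_R: "abelian_group R"
proof (rule abelian_groupI)
  fix f assume f: "f \<in> carrier R"
  show "\<exists>g\<in>carrier R. g \<oplus>\<^bsub>R\<^esub> f = \<zero>\<^bsub>R\<^esub>"
    using f by (intro bexI[of _ "\<lambda>x\<in>topspace X. - f x"]) (auto simp: S_uminus cong: restrict_cong)
  show "\<zero>\<^bsub>R\<^esub> \<oplus>\<^bsub>R\<^esub> f = f"
    using f S_add[OF S_zero, of f] by (intro S_eqI) auto
qed (auto simp: S_add S_zero algebra_simps cong: restrict_cong)

lemma comm_rng_R: "comm_rng R"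
  using abelian_group_R
  by (intro comm_rng.intro comm_rng_axioms.intro)
     (auto simp: S_mult algebra_simps cong: restrict_cong)

lemma R_a_inv:
  assumes "f \<in> S"
  shows "\<ominus>\<^bsub>R\<^esub> f = (\<lambda>x\<in>topspace X. - f x)"
proof -
  interpret abelian_group R by (rule abelian_group_R)
  show ?thesis
    by (rule minus_equality) (auto simp: assms S_uminus cong: restrict_cong)
qed

text \<open>A clopen \<open>C\<close> gives the terms of the descending chains. With the complement
  of a clopen set in place of \<open>C\<close> this is the ideal of functions vanishing on that set,
  which gives the ascending chains.\<close>

definition supported_in :: "'a set \<Rightarrow> ('a \<Rightarrow> real) set" where
  "supported_in C = {f \<in> S. \<forall>x\<in>topspace X - C. f x = 0}"

lemma rng_ideal_supported_in: "rng_ideal (supported_in C) R"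
proof -
  interpret abelian_group R by (rule abelian_group_R)
  have "subgroup (supported_in C) (add_monoid R)"
  proof (rule group.subgroupI)
    show "Group.group (add_monoid R)"
      by (rule a_group)
    show "supported_in C \<noteq> {}"
      using S_zero by (auto simp: supported_in_def)
    fix f assume f: "f \<in> supported_in C"
    then have "\<ominus>\<^bsub>R\<^esub> f \<in> supported_in C"
      by (auto simp: supported_in_def R_a_inv S_uminus)
    then show "inv\<^bsub>add_monoid R\<^esub> f \<in> supported_in C"
      by (simp add: a_inv_def)
  next
    fix f g assume "f \<in> supported_in C" "g \<in> supported_in C"
    then show "f \<otimes>\<^bsub>add_monoid R\<^esub> g \<in> supported_in C"
      by (auto simp: supported_in_def S_add)
  qed (auto simp: supported_in_def)
  then have "additive_subgroup (supported_in C) R"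
    by (rule additive_subgroup.intro)
  then show ?thesis
    using comm_rng_R
    by (intro rng_ideal.intro rng_ideal_axioms.intro) (auto simp: supported_in_def S_mult)
qed

end

section \<open>Infinite spaces: strict chains of ideals\<close>

text \<open>The assumption \<open>local_steps\<close> stands in for the family \<open>P\<close>: it
  is all that the chain arguments ask of the local condition, and both rings satisfy it.\<close>

locale zero_dim_fun_rng = real_fun_rng +
  assumes zero_dim: "zero_dimensional_space X"
    and Hausdorff: "Hausdorff_space X"
    and local_steps: "x \<in> topspace X \<Longrightarrow> \<exists>U. openin X U \<and> x \<in> U \<and>
      (\<forall>A c. openin X A \<and> closedin X A \<and> A \<subseteq> U \<longrightarrow> step_fun X A c \<in> S)"
begin

text \<open>Any point of \<open>D - C\<close> has a clopen neighbourhood \<open>V\<close> that stays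
  in \<open>D - C\<close> and is small enough for its indicator to be in \<open>S\<close>. That
  indicator tells the two ideals apart.\<close>

lemma supported_in_neq:
  assumes "openin X C" "closedin X C" "openin X D" "closedin X D" "C \<subset> D"
  shows "supported_in C \<noteq> supported_in D"
proof -
  obtain x where x: "x \<in> D - C"
    using assms by blast
  then have xX: "x \<in> topspace X"
    using openin_subset[OF assms(3)] by auto
  obtain U where U: "openin X U" "x \<in> U"
      "\<And>A c. openin X A \<Longrightarrow> closedin X A \<Longrightarrow> A \<subseteq> U \<Longrightarrow> step_fun X A c \<in> S"
    using local_steps[OF xX] by blast
  have "openin X (U \<inter> (D - C))"
    using U(1) assms by (intro openin_Int openin_diff)
  then obtain V where V: "openin X V" "closedin X V" "x \<in> V" "V \<subseteq> U \<inter> (D - C)"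
    using zero_dimensional_space_base[OF zero_dim, of _ x] x U(2) by blast
  have "step_fun X V 1 \<in> supported_in D" "step_fun X V 1 \<notin> supported_in C"
    using V x xX U(3)[of V 1] by (auto simp: supported_in_def step_fun_def)
  then show ?thesis
    by blast
qed

text \<open>A clopen \<open>V\<close> containing \<open>x\<close> but not \<open>y\<close> cuts
  \<open>A\<close> into two clopen pieces, each missing one of these points and hence proper. At
  least one piece is infinite.\<close>

lemma infinite_clopen_shrink:
  assumes "openin X A" "closedin X A" "infinite A"
  shows "\<exists>B. openin X B \<and> closedin X B \<and> infinite B \<and> B \<subset> A"
proof -
  obtain x where x: "x \<in> A"
    using infinite_imp_nonempty[OF assms(3)] by blast
  obtain y where y: "y \<in> A" "y \<noteq> x"
    using infinite_imp_nonempty[OF infinite_remove[OF assms(3), of x]] by blast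
  have "x \<in> topspace X" "y \<in> topspace X"
    using x y openin_subset[OF assms(1)] by auto
  then obtain U W where U: "openin X U" "openin X W" "x \<in> U" "y \<in> W" "disjnt U W"
    using Hausdorff y(2) unfolding Hausdorff_space_def by metis
  obtain V where V: "openin X V" "closedin X V" "x \<in> V" "V \<subseteq> U"
    using zero_dimensional_space_base[OF zero_dim U(1,3)] .
  have yV: "y \<notin> V"
    using U V by (auto simp: disjnt_def)
  have "infinite (A \<inter> V) \<or> infinite (A - V)"
    using assms(3) by (metis Int_Diff_Un finite_Un)
  then show ?thesis
  proof
    assume "infinite (A \<inter> V)"
    then show ?thesis
      using assms V y yV by (intro exI[of _ "A \<inter> V"]) auto
  next
    assume "infinite (A - V)"
    then show ?thesis
      using assms V x by (intro exI[of _ "A - V"]) (auto intro: openin_diff closedin_diff)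
  qed
qed

text \<open>Infinitude is carried along as an invariant of the choice, since it is what permits the
  next shrinking; it is dropped at the end.\<close>

lemma infinite_strict_clopen_chain:
  assumes "infinite (topspace X)"
  shows "\<exists>A. \<forall>n::nat. openin X (A n) \<and> closedin X (A n) \<and> A (Suc n) \<subset> A n"
proof -
  have "\<exists>A. \<forall>n::nat. (openin X (A n) \<and> closedin X (A n) \<and> infinite (A n)) \<and> A (Suc n) \<subset> A n"
  proof (rule dependent_nat_choice)
    show "\<exists>A. openin X A \<and> closedin X A \<and> infinite A"
      using assms by (intro exI[of _ "topspace X"]) auto
  next
    fix A and n :: nat
    assume "openin X A \<and> closedin X A \<and> infinite A"
    then have "\<exists>B. openin X B \<and> closedin X B \<and> infinite B \<and> B \<subset> A"
      using infinite_clopen_shrink by blast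
    then show "\<exists>B. (openin X B \<and> closedin X B \<and> infinite B) \<and> B \<subset> A"
      by (simp only: conj_assoc)
  qed
  then show ?thesis
    by (elim ex_forward) simp
qed

lemma not_artinian_if_infinite:
  assumes "infinite (topspace X)"
  shows "\<not> artinian_rng R"
proof
  assume R: "artinian_rng R"
  obtain A :: "nat \<Rightarrow> 'a set"
    where "\<forall>n. openin X (A n) \<and> closedin X (A n) \<and> A (Suc n) \<subset> A n"
    using infinite_strict_clopen_chain[OF assms] ..
  then have A: "openin X (A n)" "closedin X (A n)" "A (Suc n) \<subset> A n" for n
    by simp_all
  have "supported_in (A (Suc n)) \<subseteq> supported_in (A n)" for n
    using A(3)[of n] by (auto simp: supported_in_def)
  then have "\<exists>N. \<forall>n\<ge>N. supported_in (A n) = supported_in (A N)"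
    by (rule artinian_rng.descending_chain[OF R rng_ideal_supported_in])
  then obtain N where N: "\<forall>n\<ge>N. supported_in (A n) = supported_in (A N)" ..
  have "supported_in (A (Suc N)) = supported_in (A N)"
    using N[rule_format, of "Suc N"] by simp
  then show False
    using supported_in_neq[OF A(1,2) A(1,2) A(3), of N] by simp
qed

lemma not_noetherian_if_infinite:
  assumes "infinite (topspace X)"
  shows "\<not> noetherian_rng R"
proof
  assume R: "noetherian_rng R"
  obtain A :: "nat \<Rightarrow> 'a set"
    where "\<forall>n. openin X (A n) \<and> closedin X (A n) \<and> A (Suc n) \<subset> A n"
    using infinite_strict_clopen_chain[OF assms] ..
  then have A: "openin X (A n)" "closedin X (A n)" "A (Suc n) \<subset> A n" for n
    by simp_all
  \<comment> \<open>Complements turn the shrinking clopen sequence into a growing one. Strictness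
    survives because every \<open>A n\<close> lies in \<open>topspace X\<close>.\<close>
  define B where "B n = topspace X - A n" for n
  have B: "openin X (B n)" "closedin X (B n)" "B n \<subset> B (Suc n)" for n
    using A(1,2)[of n] A(3)[of n] openin_subset[OF A(1), of n] by (auto simp: B_def)
  have "supported_in (B n) \<subseteq> supported_in (B (Suc n))" for n
    using B(3)[of n] by (auto simp: supported_in_def)
  then have "\<exists>N. \<forall>n\<ge>N. supported_in (B n) = supported_in (B N)"
    by (rule noetherian_rng.ascending_chain[OF R rng_ideal_supported_in])
  then obtain N where N: "\<forall>n\<ge>N. supported_in (B n) = supported_in (B N)" ..
  have "supported_in (B (Suc N)) = supported_in (B N)"
    using N[rule_format, of "Suc N"] by simp
  then show False
    using supported_in_neq[OF B(1,2) B(1,2) B(3), of N] by simp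
qed

section \<open>Finite spaces: ideals determined by their supports\<close>

text \<open>A finite Hausdorff space is discrete, so \<open>{x}\<close> is a clopen subset of the
  neighbourhood supplied by \<open>local_steps\<close>.\<close>

lemma singleton_step_fun_in_S:
  assumes "finite (topspace X)" "x \<in> topspace X"
  shows "step_fun X {x} c \<in> S"
proof -
  have "closedin X F" if "F \<subseteq> topspace X" for F
    using that assms(1) Hausdorff
    by (meson closedin_Hausdorff_finite finite_subset)
  then have "closedin X {x}" "closedin X (topspace X - {x})"
    using assms(2) by auto
  then have "openin X {x}" "closedin X {x}"
    using assms(2) by (auto simp: openin_closedin_eq)
  then show ?thesis
    using local_steps[OF assms(2)] by auto
qed

definition ideal_support :: "('a \<Rightarrow> real) set \<Rightarrow> 'a set" where
  "ideal_support I = {x \<in> topspace X. \<exists>f\<in>I. f x \<noteq> 0}"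

text \<open>Only the inclusion from right to left needs work: a function vanishing off the support
  is rebuilt inside \<open>I\<close> one point at a time, from members of \<open>I\<close>
  multiplied by singleton step functions.\<close>

lemma ideal_eq_supported_in:
  assumes fin: "finite (topspace X)" and I: "rng_ideal I R"
  shows "I = supported_in (ideal_support I)"
proof
  interpret rng_ideal I R by (rule I)
  note I_closed = additive_subgroup.zero_closed[OF additive_subgroup_axioms]
    additive_subgroup.a_closed[OF additive_subgroup_axioms]
  have IS: "I \<subseteq> S"
    using a_subset by simp
  then show "I \<subseteq> supported_in (ideal_support I)"
    by (auto simp: supported_in_def ideal_support_def)
  show "supported_in (ideal_support I) \<subseteq> I"
  proof
    fix f assume f: "f \<in> supported_in (ideal_support I)"
    \<comment> \<open>Truncations of \<open>f\<close> are built up by induction on the set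
      \<open>F\<close> of points kept; the whole space gives \<open>f\<close> back.\<close>
    have "(\<lambda>x\<in>topspace X. if x \<in> F then f x else 0) \<in> I" if "finite F" "F \<subseteq> topspace X" for F
      using that
    proof (induction F)
      case empty
      then show ?case
        using I_closed(1) by (simp add: restrict_def)
    next
      case (insert a F)
      define h where "h = (\<lambda>x\<in>topspace X. if x \<in> F then f x else 0)"
      have h: "h \<in> I"
        unfolding h_def using insert.IH insert.prems by blast
      have a: "a \<in> topspace X"
        using insert by simp
      show ?case
      proof (cases "f a = 0")
        case True
        then have "(\<lambda>x\<in>topspace X. if x \<in> insert a F then f x else 0) = h"
          by (auto simp: h_def fun_eq_iff)
        then show ?thesis
          using h by simp
      next
        case False
        \<comment> \<open>Since \<open>f\<close> vanishes off the support of \<open>I\<close>, a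
          nonzero value at \<open>a\<close> puts \<open>a\<close> in that support.\<close>
        then obtain g where g: "g \<in> I" "g a \<noteq> 0"
          using f a by (auto simp: supported_in_def ideal_support_def)
        \<comment> \<open>The product has value \<open>f a\<close> at \<open>a\<close> and 0
          elsewhere. As \<open>a\<close> is not in \<open>F\<close>, adding it to \<open>h\<close>
          changes the value at \<open>a\<close> only.\<close>
        have "h \<oplus>\<^bsub>R\<^esub> (step_fun X {a} (f a / g a) \<otimes>\<^bsub>R\<^esub> g) \<in> I"
          by (rule I_closed(2)[OF h rng_I_closed[OF g(1)]])
             (simp add: singleton_step_fun_in_S[OF fin a])
        also have "h \<oplus>\<^bsub>R\<^esub> (step_fun X {a} (f a / g a) \<otimes>\<^bsub>R\<^esub> g) =
            (\<lambda>x\<in>topspace X. if x \<in> insert a F then f x else 0)"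
          using g(2) insert.hyps by (auto simp: h_def step_fun_def fun_eq_iff)
        finally show ?thesis .
      qed
    qed
    from this[of "topspace X"] fin
    have "(\<lambda>x\<in>topspace X. if x \<in> topspace X then f x else 0) \<in> I"
      by simp
    moreover have "(\<lambda>x\<in>topspace X. if x \<in> topspace X then f x else 0) = f"
      using f S_extensional[of f]
      by (auto simp: supported_in_def fun_eq_iff extensional_def)
    ultimately show "f \<in> I"
      by simp
  qed
qed

lemma finite_ideals:
  assumes "finite (topspace X)"
  shows "finite {I. rng_ideal I R}"
proof (rule finite_subset)
  show "{I. rng_ideal I R} \<subseteq> supported_in ` Pow (topspace X)"
    using ideal_eq_supported_in[OF assms] by (auto simp: ideal_support_def)
qed (use assms in simp)

text \<open>A chain takes finitely many values, so some \<open>I N\<close> is maximal among them;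
  all later terms contain it and hence equal it.\<close>

lemma noetherian_if_finite:
  assumes "finite (topspace X)"
  shows "noetherian_rng R"
proof (intro noetherian_rng.intro noetherian_rng_axioms.intro comm_rng_R)
  fix I :: "nat \<Rightarrow> ('a \<Rightarrow> real) set"
  assume I: "\<And>n. rng_ideal (I n) R" "\<And>n. I n \<subseteq> I (Suc n)"
  have "finite (range I)"
    using I(1) by (intro finite_subset[OF _ finite_ideals[OF assms]]) auto
  then obtain N where N: "\<forall>M\<in>range I. I N \<subseteq> M \<longrightarrow> I N = M"
    using finite_has_maximal[of "range I"] by auto
  have "I n = I N" if "N \<le> n" for n
  proof -
    have "I N \<subseteq> I n"
      by (rule lift_Suc_mono_le[of I, OF I(2) that])
    then show ?thesis
      using N by blast
  qed
  then show "\<exists>N. \<forall>n\<ge>N. I n = I N"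
    by blast
qed

text \<open>As in the ascending case, with a minimal value in place of a maximal one.\<close>

lemma artinian_if_finite:
  assumes "finite (topspace X)"
  shows "artinian_rng R"
proof (intro artinian_rng.intro artinian_rng_axioms.intro comm_rng_R)
  fix I :: "nat \<Rightarrow> ('a \<Rightarrow> real) set"
  assume I: "\<And>n. rng_ideal (I n) R" "\<And>n. I (Suc n) \<subseteq> I n"
  have "finite (range I)"
    using I(1) by (intro finite_subset[OF _ finite_ideals[OF assms]]) auto
  then obtain N where N: "\<forall>M\<in>range I. M \<subseteq> I N \<longrightarrow> I N = M"
    using finite_has_minimal[of "range I"] by auto
  have "I n = I N" if "N \<le> n" for n
  proof -
    have "I n \<subseteq> I N"
      by (rule lift_Suc_antimono_le[of I, OF I(2) that])
    then show ?thesis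
      using N by blast
  qed
  then show "\<exists>N. \<forall>n\<ge>N. I n = I N"
    by blast
qed

lemma noetherian_iff_finite: "noetherian_rng R \<longleftrightarrow> finite (topspace X)"
  using noetherian_if_finite not_noetherian_if_infinite by blast

lemma artinian_iff_finite: "artinian_rng R \<longleftrightarrow> finite (topspace X)"
  using artinian_if_finite not_artinian_if_infinite by blast

end

section \<open>The rings defined by countable range and by \<open>P\<close>\<close>

lemma real_fun_rng_C_countable: "real_fun_rng X (C_countable X)"
proof
  show "C_countable X \<subseteq> carrier (cont_ring X)"
    by (auto simp: C_countable_def)
  show "(\<lambda>x\<in>topspace X. 0) \<in> C_countable X"
    \<comment> \<open>The zero function is a step function on the empty clopen set.\<close>
    using step_fun_in_C_countable[of X "{}" 0] by (simp add: step_fun_def)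
next
  fix f assume "f \<in> C_countable X"
  then have f: "continuous_map X euclideanreal f" "countable (f ` topspace X)"
    by (auto simp: C_countable_def cont_ring_def)
  have "countable ((\<lambda>x. - f x) ` topspace X)"
    using countable_image[OF f(2), of uminus] by (simp add: image_image)
  then show "(\<lambda>x\<in>topspace X. - f x) \<in> C_countable X"
    using f by (auto simp: C_countable_def cont_ring_def continuous_map_minus cong: image_cong
        intro: continuous_map_eq[where f = "\<lambda>x. - f x"])
next
  fix f g assume "f \<in> C_countable X" "g \<in> C_countable X"
  then have fg: "continuous_map X euclideanreal f" "countable (f ` topspace X)"
      "continuous_map X euclideanreal g" "countable (g ` topspace X)"
    by (auto simp: C_countable_def cont_ring_def)
  \<comment> \<open>The values lie in the image under \<open>h\<close> of a product of two countable
    ranges, which covers sums and products alike.\<close>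
  have *: "countable ((\<lambda>x. h (f x) (g x)) ` topspace X)" for h :: "real \<Rightarrow> real \<Rightarrow> real"
    by (rule countable_subset[of _ "case_prod h ` (f ` topspace X \<times> g ` topspace X)"])
       (use fg in auto)
  show "(\<lambda>x\<in>topspace X. f x + g x) \<in> C_countable X"
    using fg *[of "(+)"] by (auto simp: C_countable_def cont_ring_def cong: image_cong
        intro: continuous_map_eq[OF continuous_map_add[OF fg(1,3)]])
  show "(\<lambda>x\<in>topspace X. f x * g x) \<in> C_countable X"
    using fg *[of "(*)"] by (auto simp: C_countable_def cont_ring_def cong: image_cong
        intro: continuous_map_eq[OF continuous_map_real_mult[OF fg(1,3)]])
qed

lemma closed_set_idealD:
  assumes "closed_set_ideal X P"
  shows "{} \<in> P"
    and "A \<in> P \<Longrightarrow> B \<in> P \<Longrightarrow> A \<union> B \<in> P"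
    and "A \<in> P \<Longrightarrow> closedin X B \<Longrightarrow> B \<subseteq> A \<Longrightarrow> B \<in> P"
proof -
  have *: "\<Union>F \<in> P" if "finite F" "F \<subseteq> P" for F
    using assms that by (auto simp: closed_set_ideal_def)
  show "{} \<in> P"
    using *[of "{}"] by simp
  show "A \<in> P \<Longrightarrow> B \<in> P \<Longrightarrow> A \<union> B \<in> P"
    using *[of "{A, B}"] by simp
  show "A \<in> P \<Longrightarrow> closedin X B \<Longrightarrow> B \<subseteq> A \<Longrightarrow> B \<in> P"
    using assms unfolding closed_set_ideal_def by blast
qed

text \<open>Subsets of \<open>U\<close> lie in the closure of \<open>U\<close>, a member of
  \<open>P\<close>, so the closed ones are members too.\<close>

lemma locally_in_closed_subsets:
  assumes "closed_set_ideal X P" "locally_in X P" "x \<in> topspace X"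
  obtains U where "openin X U" "x \<in> U" "\<And>A. closedin X A \<Longrightarrow> A \<subseteq> U \<Longrightarrow> A \<in> P"
proof -
  obtain U where U: "openin X U" "x \<in> U" "X closure_of U \<in> P"
    using assms(2,3) by (auto simp: locally_in_def)
  have "A \<in> P" if "closedin X A" "A \<subseteq> U" for A
    using closed_set_idealD(3)[OF assms(1) U(3) that(1)] that(2)
      closure_of_subset[OF openin_subset[OF U(1)]] by auto
  then show thesis
    using that U by blast
qed

text \<open>Near each point all clopen sets are members of \<open>P\<close>, so
  \<open>local_steps\<close> reduces to step functions on clopen members of
  \<open>P\<close>.\<close>

lemma zero_dim_fun_rngI:
  assumes "zero_dimensional_space X" "Hausdorff_space X" "closed_set_ideal X P" "locally_in X P"
    and "real_fun_rng X S"
    and steps: "\<And>A c. openin X A \<Longrightarrow> closedin X A \<Longrightarrow> A \<in> P \<Longrightarrow> step_fun X A c \<in> S"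
  shows "zero_dim_fun_rng X S"
proof (intro zero_dim_fun_rng.intro zero_dim_fun_rng_axioms.intro assms(1,2,5))
  fix x assume "x \<in> topspace X"
  then obtain U where U: "openin X U" "x \<in> U" "\<And>A. closedin X A \<Longrightarrow> A \<subseteq> U \<Longrightarrow> A \<in> P"
    by (rule locally_in_closed_subsets[OF assms(3,4)]) blast
  then show "\<exists>U. openin X U \<and> x \<in> U \<and>
      (\<forall>A c. openin X A \<and> closedin X A \<and> A \<subseteq> U \<longrightarrow> step_fun X A c \<in> S)"
    using steps by blast
qed

text \<open>As \<open>A\<close> is closed, the closure of the cozero set stays inside
  \<open>A\<close>. Together with \<open>C_ideal_cozero\<close> this trades the closure for
  containment in some member of \<open>P\<close>, a condition that is easy to combine.\<close>

lemma C_idealI: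
  assumes "closed_set_ideal X P" "A \<in> P" "f \<in> carrier (cont_ring X)"
    and "{x \<in> topspace X. f x \<noteq> 0} \<subseteq> A"
  shows "f \<in> C_ideal X P"
proof -
  have "closedin X A"
    using assms(1,2) by (auto simp: closed_set_ideal_def)
  moreover have "topspace X - zero_set X f = {x \<in> topspace X. f x \<noteq> 0}"
    by (auto simp: zero_set_def)
  ultimately have "X closure_of (topspace X - zero_set X f) \<subseteq> A"
    using assms(4) by (simp add: closure_of_minimal)
  then show ?thesis
    using closed_set_idealD(3)[OF assms(1,2) closedin_closure_of] assms(3)
    by (simp add: C_ideal_def)
qed

lemma C_ideal_cozero:
  assumes "f \<in> C_ideal X P"
  shows "\<exists>A\<in>P. {x \<in> topspace X. f x \<noteq> 0} \<subseteq> A"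
proof
  show "X closure_of (topspace X - zero_set X f) \<in> P"
    using assms by (simp add: C_ideal_def)
  show "{x \<in> topspace X. f x \<noteq> 0} \<subseteq> X closure_of (topspace X - zero_set X f)"
    using closure_of_subset[of "topspace X - zero_set X f" X] by (auto simp: zero_set_def)
qed

text \<open>Negation keeps the cozero set, and the cozero sets of a sum and of a product lie in the
  union of the two given ones.\<close>

lemma real_fun_rng_C_ideal:
  assumes P: "closed_set_ideal X P"
  shows "real_fun_rng X (C_ideal X P \<inter> C_countable X)"
proof -
  interpret C: real_fun_rng X "C_countable X"
    by (rule real_fun_rng_C_countable)
  note carr = subsetD[OF C.S_subset]
  show ?thesis
  proof
    show "C_ideal X P \<inter> C_countable X \<subseteq> carrier (cont_ring X)"
      using carr by auto
    have "(\<lambda>x\<in>topspace X. 0) \<in> C_ideal X P"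
      by (rule C_idealI[OF P closed_set_idealD(1)[OF P] carr[OF C.S_zero]]) auto
    then show "(\<lambda>x\<in>topspace X. 0) \<in> C_ideal X P \<inter> C_countable X"
      using C.S_zero by simp
  next
    fix f assume f: "f \<in> C_ideal X P \<inter> C_countable X"
    obtain A where A: "A \<in> P" "{x \<in> topspace X. f x \<noteq> 0} \<subseteq> A"
      using C_ideal_cozero f by blast
    have m: "(\<lambda>x\<in>topspace X. - f x) \<in> C_countable X"
      using f by (simp add: C.S_uminus)
    have "(\<lambda>x\<in>topspace X. - f x) \<in> C_ideal X P"
      by (rule C_idealI[OF P A(1) carr[OF m]]) (use A(2) in auto)
    then show "(\<lambda>x\<in>topspace X. - f x) \<in> C_ideal X P \<inter> C_countable X"
      using m by simp
  next
    fix f g assume f: "f \<in> C_ideal X P \<inter> C_countable X" and g: "g \<in> C_ideal X P \<inter> C_countable X"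
    obtain A where A: "A \<in> P" "{x \<in> topspace X. f x \<noteq> 0} \<subseteq> A"
      using C_ideal_cozero f by blast
    obtain B where B: "B \<in> P" "{x \<in> topspace X. g x \<noteq> 0} \<subseteq> B"
      using C_ideal_cozero g by blast
    have AB: "A \<union> B \<in> P"
      by (rule closed_set_idealD(2)[OF P A(1) B(1)])
    have sum: "(\<lambda>x\<in>topspace X. f x + g x) \<in> C_countable X"
      and prod: "(\<lambda>x\<in>topspace X. f x * g x) \<in> C_countable X"
      using f g by (auto simp: C.S_add C.S_mult)
    have "(\<lambda>x\<in>topspace X. f x + g x) \<in> C_ideal X P"
      by (rule C_idealI[OF P AB carr[OF sum]]) (use A(2) B(2) in fastforce)
    then show "(\<lambda>x\<in>topspace X. f x + g x) \<in> C_ideal X P \<inter> C_countable X"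
      using sum by simp
    have "(\<lambda>x\<in>topspace X. f x * g x) \<in> C_ideal X P"
      by (rule C_idealI[OF P AB carr[OF prod]]) (use A(2) B(2) in fastforce)
    then show "(\<lambda>x\<in>topspace X. f x * g x) \<in> C_ideal X P \<inter> C_countable X"
      using prod by simp
  qed
qed

text \<open>Continuity of the absolute value of \<open>f\<close> makes the level sets closed, so
  lying inside a member of \<open>P\<close> already makes them members.\<close>

lemma C_infinityI:
  assumes "closed_set_ideal X P" "f \<in> carrier (cont_ring X)"
    and "\<And>n::nat. n \<ge> 1 \<Longrightarrow> \<exists>A\<in>P. {x \<in> topspace X. \<bar>f x\<bar> \<ge> 1 / real n} \<subseteq> A"
  shows "f \<in> C_infinity X P"
proof -
  have "continuous_map X euclideanreal (\<lambda>x. \<bar>f x\<bar>)"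
    using assms(2) by (auto simp: cont_ring_def intro: continuous_map_real_abs)
  then have "closedin X {x \<in> topspace X. \<bar>f x\<bar> \<in> {1 / real n..}}" for n
    by (rule closedin_continuous_map_preimage) simp
  then have "closedin X {x \<in> topspace X. \<bar>f x\<bar> \<ge> 1 / real n}" for n
    by simp
  then show ?thesis
    using assms closed_set_idealD(3)[OF assms(1)] unfolding C_infinity_def by blast
qed

lemma C_infinityD:
  assumes "f \<in> C_infinity X P" "n \<ge> 1"
  shows "{x \<in> topspace X. \<bar>f x\<bar> \<ge> 1 / real n} \<in> P"
  using assms by (simp add: C_infinity_def)

lemma real_fun_rng_C_infinity:
  assumes P: "closed_set_ideal X P"
  shows "real_fun_rng X (C_infinity X P \<inter> C_countable X)"
proof -
  interpret C: real_fun_rng X "C_countable X"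
    by (rule real_fun_rng_C_countable)
  note carr = subsetD[OF C.S_subset]
  show ?thesis
  proof
    show "C_infinity X P \<inter> C_countable X \<subseteq> carrier (cont_ring X)"
      using carr by auto
    have "(\<lambda>x\<in>topspace X. 0) \<in> C_infinity X P"
      by (rule C_infinityI[OF P carr[OF C.S_zero]])
         (use closed_set_idealD(1)[OF P] in auto)
    then show "(\<lambda>x\<in>topspace X. 0) \<in> C_infinity X P \<inter> C_countable X"
      using C.S_zero by simp
  next
    fix f assume f: "f \<in> C_infinity X P \<inter> C_countable X"
    then have m: "(\<lambda>x\<in>topspace X. - f x) \<in> C_countable X"
      by (simp add: C.S_uminus)
    have "(\<lambda>x\<in>topspace X. - f x) \<in> C_infinity X P"
    proof (rule C_infinityI[OF P carr[OF m]])
      fix n :: nat assume "n \<ge> 1"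
      then show "\<exists>A\<in>P. {x \<in> topspace X. \<bar>(\<lambda>x\<in>topspace X. - f x) x\<bar> \<ge> 1 / real n} \<subseteq> A"
        using f by (intro bexI[OF _ C_infinityD[of f X P n]]) auto
    qed
    then show "(\<lambda>x\<in>topspace X. - f x) \<in> C_infinity X P \<inter> C_countable X"
      using m by simp
  next
    fix f g assume f: "f \<in> C_infinity X P \<inter> C_countable X"
      and g: "g \<in> C_infinity X P \<inter> C_countable X"
    have sum: "(\<lambda>x\<in>topspace X. f x + g x) \<in> C_countable X"
      and prod: "(\<lambda>x\<in>topspace X. f x * g x) \<in> C_countable X"
      using f g by (auto simp: C.S_add C.S_mult)
    let ?L = "\<lambda>f n. {x \<in> topspace X. \<bar>f x\<bar> \<ge> 1 / real n}"
    have L: "?L f m \<union> ?L g n \<in> P" if "m \<ge> 1" "n \<ge> 1" for m n :: nat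
      using f g that by (intro closed_set_idealD(2)[OF P] C_infinityD) auto
    have "(\<lambda>x\<in>topspace X. f x + g x) \<in> C_infinity X P"
    proof (rule C_infinityI[OF P carr[OF sum]])
      fix n :: nat assume n: "n \<ge> 1"
      \<comment> \<open>By the triangle inequality one summand reaches half the threshold, so the
        level set of the sum is covered by level sets of \<open>f\<close> and \<open>g\<close> at
        \<open>2 * n\<close>.\<close>
      have "1 / real (2 * n) \<le> \<bar>f x\<bar> \<or> 1 / real (2 * n) \<le> \<bar>g x\<bar>"
        if "1 / real n \<le> \<bar>f x + g x\<bar>" for x
      proof -
        have "1 / real n = 1 / real (2 * n) + 1 / real (2 * n)"
          by (simp add: field_simps)
        then show ?thesis
          using that abs_triangle_ineq[of "f x" "g x"] by linarith
      qed
      then show "\<exists>A\<in>P. ?L (\<lambda>x\<in>topspace X. f x + g x) n \<subseteq> A"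
        using n by (intro bexI[OF _ L[of "2 * n" "2 * n"]]) auto
    qed
    then show "(\<lambda>x\<in>topspace X. f x + g x) \<in> C_infinity X P \<inter> C_countable X"
      using sum by simp
    have "(\<lambda>x\<in>topspace X. f x * g x) \<in> C_infinity X P"
    proof (rule C_infinityI[OF P carr[OF prod]])
      fix n :: nat assume n: "n \<ge> 1"
      \<comment> \<open>The thresholds \<open>1 / real n\<close> for \<open>f\<close> and 1 for
        \<open>g\<close> multiply to \<open>1 / real n\<close>, so a product reaching it must reach
        one of them in its factor.\<close>
      have "1 / real n \<le> \<bar>f x\<bar> \<or> 1 / real 1 \<le> \<bar>g x\<bar>"
        if "1 / real n \<le> \<bar>f x * g x\<bar>" for x
      proof (rule ccontr)
        assume "\<not> ?thesis"
        then have "\<bar>f x\<bar> * \<bar>g x\<bar> < 1 / real n * 1"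
          by (intro mult_strict_mono') auto
        then show False
          using that by (simp add: abs_mult)
      qed
      then show "\<exists>A\<in>P. ?L (\<lambda>x\<in>topspace X. f x * g x) n \<subseteq> A"
        using n by (intro bexI[OF _ L[of n 1]]) auto
    qed
    then show "(\<lambda>x\<in>topspace X. f x * g x) \<in> C_infinity X P \<inter> C_countable X"
      using prod by simp
  qed
qed

section \<open>The chain conditions and finiteness\<close>

theorem theorem6p4:
  fixes X :: "'a topology" and P :: "'a set set"
  assumes "zero_dimensional_space X"
    and "Hausdorff_space X"
    and "closed_set_ideal X P"
    and "locally_in X P"
  shows "(noetherian_rng (subring_on X (C_ideal X P \<inter> C_countable X)) \<longleftrightarrow>
          artinian_rng (subring_on X (C_ideal X P \<inter> C_countable X))) \<and>
         (artinian_rng (subring_on X (C_ideal X P \<inter> C_countable X)) \<longleftrightarrow>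
          noetherian_rng (subring_on X (C_infinity X P \<inter> C_countable X))) \<and>
         (noetherian_rng (subring_on X (C_infinity X P \<inter> C_countable X)) \<longleftrightarrow>
          artinian_rng (subring_on X (C_infinity X P \<inter> C_countable X))) \<and>
         (artinian_rng (subring_on X (C_infinity X P \<inter> C_countable X)) \<longleftrightarrow>
          finite (topspace X))"
proof -
  have cozero: "{x \<in> topspace X. step_fun X A c x \<noteq> 0} \<subseteq> A" for A c
    by (auto simp: step_fun_def)
  interpret I: zero_dim_fun_rng X "C_ideal X P \<inter> C_countable X"
    using assms
  proof (rule zero_dim_fun_rngI[OF _ _ _ _ real_fun_rng_C_ideal[OF assms(3)]])
    fix A c assume A: "openin X A" "closedin X A" "A \<in> P"
    show "step_fun X A c \<in> C_ideal X P \<inter> C_countable X"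
      using C_idealI[OF assms(3) A(3) step_fun_in_carrier cozero]
        step_fun_in_C_countable A by auto
  qed
  interpret J: zero_dim_fun_rng X "C_infinity X P \<inter> C_countable X"
    using assms
  proof (rule zero_dim_fun_rngI[OF _ _ _ _ real_fun_rng_C_infinity[OF assms(3)]])
    fix A c assume A: "openin X A" "closedin X A" "A \<in> P"
    have "step_fun X A c \<in> C_infinity X P"
    proof (rule C_infinityI[OF assms(3) step_fun_in_carrier])
      fix n :: nat assume "n \<ge> 1"
      \<comment> \<open>Since \<open>n \<ge> 1\<close>, the threshold is positive and the level set
        lies in the cozero set. For \<open>n = 0\<close> the convention \<open>1 / 0 = 0\<close>
        would make it the whole space.\<close>
      then have "{x \<in> topspace X. \<bar>step_fun X A c x\<bar> \<ge> 1 / real n} \<subseteq> A"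
        using cozero[of A c] by fastforce
      then show "\<exists>B\<in>P. {x \<in> topspace X. \<bar>step_fun X A c x\<bar> \<ge> 1 / real n} \<subseteq> B"
        using A(3) by blast
    qed (use A in auto)
    then show "step_fun X A c \<in> C_infinity X P \<inter> C_countable X"
      using step_fun_in_C_countable A by auto
  qed
  \<comment> \<open>Each of the four ring conditions is equivalent to finiteness of
    \<open>topspace X\<close>, which closes the cycle.\<close>
  show ?thesis
    by (simp add: I.noetherian_iff_finite I.artinian_iff_finite
        J.noetherian_iff_finite J.artinian_iff_finite)
qed

end
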